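(* Consider two call types $1,2$ with parameters $\nu_r>0$, $\mu_r>0$, $\kappa_r=\nu_r/\mu_r$ ($r=1,2$), and capacities $0<c_2\le c_1<\infty$, where feasibility of a control $\boldsymbol{b}$ means that $b_1(\boldsymbol{n})+b_2(\boldsymbol{n})\le c_1$ and $b_2(\boldsymbol{n})\le c_2$ for all $\boldsymbol{n}\in\mathbb{Z}_+^2$. Assume that $$\kappa_1+\kappa_2<c_1,\qquad \kappa_2<c_2.$$ Then, given any $\delta>0$, there is some $a\ge1$ (depending only on $\nu_r,\mu_r,c_j$ and $\delta$) such that every Pareto efficient control $\boldsymbol{b}$ for which there exists a finite set $F\subset\mathbb{Z}_+^2$ with $$\kappa_2-b_2(\boldsymbol{n})\le-\delta\qquad\text{whenever } n_1<a \text{ and } \boldsymbol{n}\notin F$$ is stable.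
   Context: $\mathbb{Z}_+=\{0,1,2,\dots\}$. A control is a function $\boldsymbol{b}=(b_1,b_2):\mathbb{Z}_+^2\to[0,\infty)^2$ with $b_r(\boldsymbol{n})=0$ whenever $n_r=0$. It defines the continuous-time Markov process $\boldsymbol{n}(\cdot)$ on $\mathbb{Z}_+^2$ with transitions, for $r=1,2$: $\boldsymbol{n}\to\boldsymbol{n}+\boldsymbol{e}_r$ at rate $\nu_r$ and $\boldsymbol{n}\to\boldsymbol{n}-\boldsymbol{e}_r$ at rate $\mu_r b_r(\boldsymbol{n})$, where $\boldsymbol{e}_r$ is the $r$th unit vector. The control is stable if this process is positive recurrent. There are two resources: resource 1 (capacity $c_1$) is used by calls of both types and resource 2 (capacity $c_2$) by calls of type 2 only. For a feasible control, resource 1 is saturated at $\boldsymbol{n}$ if $b_1(\boldsymbol{n})+b_2(\boldsymbol{n})=c_1$, and resource 2 is saturated at $\boldsymbol{n}$ if $b_2(\boldsymbol{n})=c_2$. A control is Pareto efficient if it is feasible and, for all $\boldsymbol{n}$ and all $r$ with $n_r>0$, at least one of the resources used by type $r$ is saturated at $\boldsymbol{n}$. *)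

theory Defs
  imports "HOL-Probability.Probability"
begin

section \<open>Continuous-time Markov chains on a countable state space\<close>

text \<open>
  A chain is given by its transition rates: \<open>q x y\<close> is the rate of the transition
  \<open>x \<rightarrow> y\<close> for \<open>x \<noteq> y\<close>, and \<open>q x x = 0\<close>.
\<close>

definition exit_rate :: "('s \<Rightarrow> 's \<Rightarrow> real) \<Rightarrow> 's \<Rightarrow> real" where
  "exit_rate q x = (\<Sum>\<^sub>\<infinity>y. q x y)"

definition jump_pmf :: "('s \<Rightarrow> 's \<Rightarrow> real) \<Rightarrow> 's \<Rightarrow> 's pmf" where
  "jump_pmf q x =
     (if exit_rate q x = 0 then return_pmf x else embed_pmf (\<lambda>y. q x y / exit_rate q x))"

text \<open>
  The (minimal) process is realised from its jump chain and holding times, both driven by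
  an i.i.d. sequence \<open>\<omega>\<close>.  The first component of \<open>\<omega> k\<close> is exponential with mean \<open>1\<close>
  and is scaled to give the holding time in the \<open>k\<close>th state visited; the second component holds,
  independently for each state \<open>x\<close>, a successor of \<open>x\<close> drawn from \<open>jump_pmf q x\<close>.
\<close>

definition driver :: "('s \<Rightarrow> 's \<Rightarrow> real) \<Rightarrow> (nat \<Rightarrow> real \<times> ('s \<Rightarrow> 's)) measure" where
  "driver q = (\<Pi>\<^sub>M k\<in>UNIV. density lborel (exponential_density 1)
                 \<Otimes>\<^sub>M (\<Pi>\<^sub>M x\<in>UNIV. measure_pmf (jump_pmf q x)))"

primrec jump_chain :: "'s \<Rightarrow> (nat \<Rightarrow> real \<times> ('s \<Rightarrow> 's)) \<Rightarrow> nat \<Rightarrow> 's" where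
  "jump_chain x \<omega> 0 = x"
| "jump_chain x \<omega> (Suc k) = snd (\<omega> k) (jump_chain x \<omega> k)"

text \<open>Dividing by \<open>0\<close> in \<^typ>\<open>ennreal\<close> makes the holding time in an absorbing state infinite.\<close>

definition holding_time ::
    "('s \<Rightarrow> 's \<Rightarrow> real) \<Rightarrow> 's \<Rightarrow> (nat \<Rightarrow> real \<times> ('s \<Rightarrow> 's)) \<Rightarrow> nat \<Rightarrow> ennreal" where
  "holding_time q x \<omega> k = ennreal (fst (\<omega> k)) / ennreal (exit_rate q (jump_chain x \<omega> k))"

definition jump_time ::
    "('s \<Rightarrow> 's \<Rightarrow> real) \<Rightarrow> 's \<Rightarrow> (nat \<Rightarrow> real \<times> ('s \<Rightarrow> 's)) \<Rightarrow> nat \<Rightarrow> ennreal" where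
  "jump_time q x \<omega> k = (\<Sum>i<k. holding_time q x \<omega> i)"

text \<open>
  The state at time \<open>t\<close> of the process started in \<open>x\<close>, which is the \<open>k\<close>th state of the jump chain
  when \<open>t\<close> lies between the \<open>k\<close>th and the \<open>(k+1)\<close>st jump time; \<^const>\<open>None\<close> after an explosion.
\<close>

definition process_at ::
    "('s \<Rightarrow> 's \<Rightarrow> real) \<Rightarrow> 's \<Rightarrow> (nat \<Rightarrow> real \<times> ('s \<Rightarrow> 's)) \<Rightarrow> ennreal \<Rightarrow> 's option" where
  "process_at q x \<omega> t =
     (if \<exists>k. t < jump_time q x \<omega> (Suc k)
      then Some (jump_chain x \<omega> (LEAST k. t < jump_time q x \<omega> (Suc k)))
      else None)"

definition return_time ::
    "('s \<Rightarrow> 's \<Rightarrow> real) \<Rightarrow> 's \<Rightarrow> (nat \<Rightarrow> real \<times> ('s \<Rightarrow> 's)) \<Rightarrow> ennreal" where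
  "return_time q x \<omega> = Inf {t. jump_time q x \<omega> 1 \<le> t \<and> process_at q x \<omega> t = Some x}"

definition positive_recurrent :: "('s \<Rightarrow> 's \<Rightarrow> real) \<Rightarrow> bool" where
  "positive_recurrent q \<longleftrightarrow>
     (\<forall>x. exit_rate q x = 0 \<or> (\<integral>\<^sup>+ \<omega>. return_time q x \<omega> \<partial>driver q) < \<infinity>)"


section \<open>Controls\<close>

text \<open>In a state \<open>n\<close> there are \<open>fst n\<close> calls of type 1 and \<open>snd n\<close> calls of type 2.\<close>

type_synonym state = "nat \<times> nat"

definition is_control :: "(state \<Rightarrow> real \<times> real) \<Rightarrow> bool" where
  "is_control b \<longleftrightarrow>
     (\<forall>n. 0 \<le> fst (b n) \<and> 0 \<le> snd (b n) \<and>
          (fst n = 0 \<longrightarrow> fst (b n) = 0) \<and> (snd n = 0 \<longrightarrow> snd (b n) = 0))"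

definition feasible :: "real \<Rightarrow> real \<Rightarrow> (state \<Rightarrow> real \<times> real) \<Rightarrow> bool" where
  "feasible c1 c2 b \<longleftrightarrow> (\<forall>n. fst (b n) + snd (b n) \<le> c1 \<and> snd (b n) \<le> c2)"

definition saturated1 :: "real \<Rightarrow> (state \<Rightarrow> real \<times> real) \<Rightarrow> state \<Rightarrow> bool" where
  "saturated1 c1 b n \<longleftrightarrow> fst (b n) + snd (b n) = c1"

definition saturated2 :: "real \<Rightarrow> (state \<Rightarrow> real \<times> real) \<Rightarrow> state \<Rightarrow> bool" where
  "saturated2 c2 b n \<longleftrightarrow> snd (b n) = c2"

definition pareto_efficient :: "real \<Rightarrow> real \<Rightarrow> (state \<Rightarrow> real \<times> real) \<Rightarrow> bool" where
  "pareto_efficient c1 c2 b \<longleftrightarrow> feasible c1 c2 b \<and>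
     (\<forall>n. (0 < fst n \<longrightarrow> saturated1 c1 b n) \<and>
          (0 < snd n \<longrightarrow> saturated1 c1 b n \<or> saturated2 c2 b n))"

definition call_rate ::
    "real \<Rightarrow> real \<Rightarrow> real \<Rightarrow> real \<Rightarrow> (state \<Rightarrow> real \<times> real) \<Rightarrow> state \<Rightarrow> state \<Rightarrow> real" where
  "call_rate \<nu>1 \<nu>2 \<mu>1 \<mu>2 b n m =
     (if m = (fst n + 1, snd n) then \<nu>1 else 0) +
     (if m = (fst n, snd n + 1) then \<nu>2 else 0) +
     (if n = (fst m + 1, snd m) then \<mu>1 * fst (b n) else 0) +
     (if n = (fst m, snd m + 1) then \<mu>2 * snd (b n) else 0)"

definition stable_control ::
    "real \<Rightarrow> real \<Rightarrow> real \<Rightarrow> real \<Rightarrow> (state \<Rightarrow> real \<times> real) \<Rightarrow> bool" where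
  "stable_control \<nu>1 \<nu>2 \<mu>1 \<mu>2 b \<longleftrightarrow> positive_recurrent (call_rate \<nu>1 \<nu>2 \<mu>1 \<mu>2 b)"


section \<open>Well-definedness of the process\<close>

text \<open>
  The construction is as intended: \<^const>\<open>driver\<close> is a probability measure, \<^const>\<open>return_time\<close>
  is measurable (so that its integral is an expectation), and for a control \<^const>\<open>exit_rate\<close> and
  \<^const>\<open>jump_pmf\<close> are the total rate and the normalised rates.
\<close>

lemma prob_space_driver: "prob_space (driver q)"
proof -
  have E: "prob_space (density lborel (exponential_density 1))"
    by (rule prob_space_exponential_density) simp
  have J: "prob_space (\<Pi>\<^sub>M x\<in>UNIV. measure_pmf (jump_pmf q x))"
    by (intro prob_space_PiM prob_space_measure_pmf)
  interpret E: prob_space "density lborel (exponential_density 1)" by (rule E)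
  interpret J: prob_space "\<Pi>\<^sub>M x\<in>UNIV. measure_pmf (jump_pmf q x)" by (rule J)
  interpret pair_prob_space "density lborel (exponential_density 1)"
      "\<Pi>\<^sub>M x\<in>UNIV. measure_pmf (jump_pmf q x)" ..
  show ?thesis
    unfolding driver_def by (intro prob_space_PiM) (rule prob_space_axioms)
qed

lemma return_time_eq:
  "return_time q x \<omega> =
     (INF k\<in>{k. 1 \<le> k \<and> jump_chain x \<omega> k = x \<and> jump_time q x \<omega> k < jump_time q x \<omega> (Suc k)}.
        jump_time q x \<omega> k)"
proof -
  let ?J = "jump_time q x \<omega>" and ?Y = "jump_chain x \<omega>"
  have "incseq ?J"
    by (rule incseq_SucI) (simp add: jump_time_def)
  then have mono: "i \<le> j \<Longrightarrow> ?J i \<le> ?J j" for i j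
    by (rule incseqD)
  have Least: "(LEAST j. t < ?J (Suc j)) = k" if "?J k \<le> t" "t < ?J (Suc k)" for t k
  proof (rule Least_equality)
    show "k \<le> j" if "t < ?J (Suc j)" for j
      using mono[of "Suc j" k] that \<open>?J k \<le> t\<close> by (meson not_less not_less_eq_eq order.trans leD)
  qed fact
  have proc: "process_at q x \<omega> t = Some x \<longleftrightarrow> (\<exists>k. ?J k \<le> t \<and> t < ?J (Suc k) \<and> ?Y k = x)" for t
  proof
    assume l: "process_at q x \<omega> t = Some x"
    define k where "k = (LEAST j. t < ?J (Suc j))"
    have ex: "\<exists>j. t < ?J (Suc j)" and Y: "?Y k = x"
      using l by (auto simp: process_at_def k_def split: if_splits)
    have "t < ?J (Suc k)"
      unfolding k_def using ex by (rule LeastI_ex)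
    moreover have "?J k \<le> t"
    proof (cases k)
      case 0
      then show ?thesis by (simp add: jump_time_def)
    next
      case (Suc j)
      then show ?thesis
        using not_less_Least[of j "\<lambda>j. t < ?J (Suc j)"] by (simp add: k_def[symmetric])
    qed
    ultimately show "\<exists>k. ?J k \<le> t \<and> t < ?J (Suc k) \<and> ?Y k = x" using Y by blast
  next
    assume "\<exists>k. ?J k \<le> t \<and> t < ?J (Suc k) \<and> ?Y k = x"
    then obtain k where k: "?J k \<le> t" "t < ?J (Suc k)" "?Y k = x" by blast
    then show "process_at q x \<omega> t = Some x"
      using Least[OF k(1,2)] by (auto simp: process_at_def)
  qed
  show ?thesis
  proof (rule antisym)
    show "return_time q x \<omega> \<le>
        (INF k\<in>{k. 1 \<le> k \<and> ?Y k = x \<and> ?J k < ?J (Suc k)}. ?J k)"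
      unfolding return_time_def
    proof (intro INF_greatest Inf_lower CollectI conjI)
      fix k assume "k \<in> {k. 1 \<le> k \<and> ?Y k = x \<and> ?J k < ?J (Suc k)}"
      then have k: "1 \<le> k" "?Y k = x" "?J k < ?J (Suc k)" by auto
      show "?J 1 \<le> ?J k" using k(1) by (rule mono)
      show "process_at q x \<omega> (?J k) = Some x" unfolding proc using k by blast
    qed
  next
    show "(INF k\<in>{k. 1 \<le> k \<and> ?Y k = x \<and> ?J k < ?J (Suc k)}. ?J k) \<le> return_time q x \<omega>"
      unfolding return_time_def
    proof (rule Inf_greatest)
      fix t assume "t \<in> {t. ?J 1 \<le> t \<and> process_at q x \<omega> t = Some x}"
      then obtain k where k: "?J k \<le> t" "t < ?J (Suc k)" "?Y k = x" "?J 1 \<le> t"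
        unfolding proc by blast
      have "1 \<le> k"
        using k(2,4) by (cases k) auto
      then have "(INF k\<in>{k. 1 \<le> k \<and> ?Y k = x \<and> ?J k < ?J (Suc k)}. ?J k) \<le> ?J k"
        using k by (intro INF_lower) auto
      then show "(INF k\<in>{k. 1 \<le> k \<and> ?Y k = x \<and> ?J k < ?J (Suc k)}. ?J k) \<le> t"
        using k(1) by (rule order.trans)
    qed
  qed
qed

lemma measurable_jump_chain:
  fixes q :: "'s::countable \<Rightarrow> 's \<Rightarrow> real"
  shows "(\<lambda>\<omega>. jump_chain x \<omega> k) \<in> driver q \<rightarrow>\<^sub>M count_space UNIV"
proof (induction k)
  case 0
  then show ?case by simp
next
  case (Suc k)
  have "(\<lambda>\<omega>. snd (\<omega> k) y) \<in> driver q \<rightarrow>\<^sub>M count_space UNIV" for y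
  proof -
    have "(\<lambda>f. f y) \<in> (\<Pi>\<^sub>M x\<in>UNIV. measure_pmf (jump_pmf q x)) \<rightarrow>\<^sub>M measure_pmf (jump_pmf q y)"
      by (rule measurable_component_singleton) simp
    then have "(\<lambda>f. f y) \<in> (\<Pi>\<^sub>M x\<in>UNIV. measure_pmf (jump_pmf q x)) \<rightarrow>\<^sub>M count_space UNIV"
      by simp
    then have "(\<lambda>p. snd p y) \<in> density lborel (exponential_density 1)
        \<Otimes>\<^sub>M (\<Pi>\<^sub>M x\<in>UNIV. measure_pmf (jump_pmf q x)) \<rightarrow>\<^sub>M count_space UNIV"
      by (rule measurable_compose[OF measurable_snd])
    moreover have "(\<lambda>\<omega>. \<omega> k) \<in> driver q \<rightarrow>\<^sub>M density lborel (exponential_density 1)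
        \<Otimes>\<^sub>M (\<Pi>\<^sub>M x\<in>UNIV. measure_pmf (jump_pmf q x))"
      unfolding driver_def by (rule measurable_component_singleton) simp
    ultimately show ?thesis
      by (rule measurable_compose[rotated])
  qed
  then show ?case
    unfolding jump_chain.simps
    by (rule measurable_compose_countable[OF _ Suc.IH])
qed

lemma measurable_jump_time:
  fixes q :: "'s::countable \<Rightarrow> 's \<Rightarrow> real"
  shows "(\<lambda>\<omega>. jump_time q x \<omega> k) \<in> borel_measurable (driver q)"
proof -
  have "(\<lambda>\<omega>. \<omega> i) \<in> driver q \<rightarrow>\<^sub>M density lborel (exponential_density 1)
      \<Otimes>\<^sub>M (\<Pi>\<^sub>M x\<in>UNIV. measure_pmf (jump_pmf q x))" for i
    unfolding driver_def by (rule measurable_component_singleton) simp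
  then have "(\<lambda>\<omega>. fst (\<omega> i)) \<in> driver q \<rightarrow>\<^sub>M density lborel (exponential_density 1)" for i
    by (rule measurable_compose[OF _ measurable_fst])
  then have [measurable]: "(\<lambda>\<omega>. fst (\<omega> i)) \<in> borel_measurable (driver q)" for i
    by simp
  note [measurable] = measurable_jump_chain
  have [measurable]: "(\<lambda>\<omega>. exit_rate q (jump_chain x \<omega> i)) \<in> borel_measurable (driver q)" for i
    by (rule measurable_compose[OF measurable_jump_chain]) simp
  show ?thesis
    unfolding jump_time_def holding_time_def by measurable
qed

lemma measurable_return_time:
  fixes q :: "'s::countable \<Rightarrow> 's \<Rightarrow> real"
  shows "return_time q x \<in> borel_measurable (driver q)"
proof -
  note [measurable] = measurable_jump_chain measurable_jump_time
  have "return_time q x = (\<lambda>\<omega>. INF k.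
      if 1 \<le> k \<and> jump_chain x \<omega> k = x \<and> jump_time q x \<omega> k < jump_time q x \<omega> (Suc k)
      then jump_time q x \<omega> k else \<top>)"
  proof (rule ext)
    fix \<omega>
    let ?P = "\<lambda>k. 1 \<le> k \<and> jump_chain x \<omega> k = x \<and>
      jump_time q x \<omega> k < jump_time q x \<omega> (Suc k)"
    have "(INF k\<in>{k. ?P k}. jump_time q x \<omega> k)
        = (INF k. if ?P k then jump_time q x \<omega> k else \<top>)"
    proof (rule antisym)
      show "(INF k\<in>{k. ?P k}. jump_time q x \<omega> k)
          \<le> (INF k. if ?P k then jump_time q x \<omega> k else \<top>)"
        by (rule INF_greatest) (simp add: INF_lower)
      show "(INF k. if ?P k then jump_time q x \<omega> k else \<top>)
          \<le> (INF k\<in>{k. ?P k}. jump_time q x \<omega> k)"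
      proof (rule INF_greatest)
        fix k assume "k \<in> {k. ?P k}"
        then have "(if ?P k then jump_time q x \<omega> k else \<top>) = jump_time q x \<omega> k" by simp
        then show "(INF k. if ?P k then jump_time q x \<omega> k else \<top>) \<le> jump_time q x \<omega> k"
          using INF_lower[of k UNIV "\<lambda>k. if ?P k then jump_time q x \<omega> k else \<top>"] by simp
      qed
    qed
    then show "return_time q x \<omega> = (INF k. if ?P k then jump_time q x \<omega> k else \<top>)"
      by (simp only: return_time_eq)
  qed
  also have "\<dots> \<in> borel_measurable (driver q)"
    by measurable
  finally show ?thesis .
qed

lemma has_sum_call_rate:
  assumes "is_control b"
  shows "(call_rate \<nu>1 \<nu>2 \<mu>1 \<mu>2 b n has_sum
            (\<nu>1 + \<nu>2 + \<mu>1 * fst (b n) + \<mu>2 * snd (b n))) UNIV"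
proof -
  have single: "((\<lambda>m. if m = u then c else 0) has_sum c) UNIV" for u :: state and c :: real
    using has_sum_finite_neutralI[of "{u}" UNIV "\<lambda>m. if m = u then c else 0" c] by simp
  have dep1: "((\<lambda>m. if n = (fst m + 1, snd m) then \<mu>1 * fst (b n) else 0)
      has_sum \<mu>1 * fst (b n)) UNIV"
  proof (cases "fst n = 0")
    case True
    then have "fst (b n) = 0" using assms unfolding is_control_def by blast
    then show ?thesis using single[of n 0] by (simp only: mult_zero_right if_cancel)
  next
    case False
    then have "(n = (fst m + 1, snd m)) = (m = (fst n - 1, snd n))" for m
      by (cases n; cases m) auto
    then show ?thesis using single[of "(fst n - 1, snd n)" "\<mu>1 * fst (b n)"] by simp
  qed
  have dep2: "((\<lambda>m. if n = (fst m, snd m + 1) then \<mu>2 * snd (b n) else 0)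
      has_sum \<mu>2 * snd (b n)) UNIV"
  proof (cases "snd n = 0")
    case True
    then have "snd (b n) = 0" using assms unfolding is_control_def by blast
    then show ?thesis using single[of n 0] by (simp only: mult_zero_right if_cancel)
  next
    case False
    then have "(n = (fst m, snd m + 1)) = (m = (fst n, snd n - 1))" for m
      by (cases n; cases m) auto
    then show ?thesis using single[of "(fst n, snd n - 1)" "\<mu>2 * snd (b n)"] by simp
  qed
  show ?thesis
    unfolding call_rate_def[abs_def]
    by (intro has_sum_add single dep1 dep2)
qed

lemma exit_rate_call_rate:
  assumes "is_control b"
  shows "exit_rate (call_rate \<nu>1 \<nu>2 \<mu>1 \<mu>2 b) n = \<nu>1 + \<nu>2 + \<mu>1 * fst (b n) + \<mu>2 * snd (b n)"
  unfolding exit_rate_def by (rule infsumI[OF has_sum_call_rate[OF assms]])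

lemma pmf_jump_pmf:
  assumes nonneg: "\<And>y. 0 \<le> q x y" and summable: "q x summable_on UNIV"
    and pos: "exit_rate q x \<noteq> 0"
  shows "pmf (jump_pmf q x) y = q x y / exit_rate q x"
proof -
  have ge: "0 \<le> exit_rate q x"
    unfolding exit_rate_def by (intro infsum_nonneg nonneg)
  have asum: "Infinite_Set_Sum.abs_summable_on (q x) UNIV"
    using summable summable_on_iff_abs_summable_on_real abs_summable_equivalent by metis
  then have abs: "integrable (count_space UNIV) (q x)"
    by (simp only: Infinite_Set_Sum.abs_summable_on_def)
  have "(\<integral>\<^sup>+ y. ennreal (q x y / exit_rate q x) \<partial>count_space UNIV)
      = ennreal (\<integral>y. q x y / exit_rate q x \<partial>count_space UNIV)"
    using abs nonneg ge by (intro nn_integral_eq_integral) auto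
  also have "(\<integral>y. q x y / exit_rate q x \<partial>count_space UNIV) = 1"
    using pos infsetsum_infsum[OF asum] by (simp add: exit_rate_def infsetsum_def)
  finally have "(\<integral>\<^sup>+ y. ennreal (q x y / exit_rate q x) \<partial>count_space UNIV) = 1" by simp
  then show ?thesis
    using pos nonneg ge by (simp add: jump_pmf_def pmf_embed_pmf)
qed

lemma pmf_jump_pmf_call_rate:
  assumes "is_control b" and "0 < \<nu>1" "0 < \<nu>2" "0 < \<mu>1" "0 < \<mu>2"
  shows "pmf (jump_pmf (call_rate \<nu>1 \<nu>2 \<mu>1 \<mu>2 b) n) m
    = call_rate \<nu>1 \<nu>2 \<mu>1 \<mu>2 b n m / (\<nu>1 + \<nu>2 + \<mu>1 * fst (b n) + \<mu>2 * snd (b n))"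
proof -
  have b: "0 \<le> fst (b n)" "0 \<le> snd (b n)"
    using assms(1) unfolding is_control_def by blast+
  then have "0 < \<nu>1 + \<nu>2 + \<mu>1 * fst (b n) + \<mu>2 * snd (b n)"
    using assms by (intro add_pos_nonneg add_pos_pos) auto
  moreover have "0 \<le> call_rate \<nu>1 \<nu>2 \<mu>1 \<mu>2 b n y" for y
    using b assms unfolding call_rate_def by (intro add_nonneg_nonneg) auto
  moreover have "call_rate \<nu>1 \<nu>2 \<mu>1 \<mu>2 b n summable_on UNIV"
    using has_sum_call_rate[OF assms(1)] unfolding summable_on_def by blast
  ultimately show ?thesis
    using pmf_jump_pmf[of "call_rate \<nu>1 \<nu>2 \<mu>1 \<mu>2 b" n m] exit_rate_call_rate[OF assms(1)] by simp
qed

end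

theory Submission
  imports Defs
begin

text \<open>
  The drift of \<open>n\<^sub>r / \<mu>\<^sub>r\<close> is \<open>\<kappa>\<^sub>r - b\<^sub>r\<close>.  The workload \<open>n\<^sub>1 / \<mu>\<^sub>1 + n\<^sub>2 / \<mu>\<^sub>2\<close> has drift
  \<open>\<kappa>\<^sub>1 + \<kappa>\<^sub>2 - c\<^sub>1 < 0\<close> when \<open>n\<^sub>1 > 0\<close>, but possibly positive drift when \<open>n\<^sub>1 = 0\<close>, whereas
  \<open>n\<^sub>2 / \<mu>\<^sub>2\<close> has drift at most \<open>- \<delta>\<close> when \<open>n\<^sub>1 < a\<close>.  The Lyapunov function interpolates between
  the two: \<open>V n = (\<Sum>i<n\<^sub>1. h i) / \<mu>\<^sub>1 + n\<^sub>2 / \<mu>\<^sub>2\<close> with \<open>h i = min 1 ((i + 1) / a)\<close>.  Its drift is at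
  most the convex combination \<open>- (1 - h) \<delta> - h (c\<^sub>1 - \<kappa>\<^sub>1 - \<kappa>\<^sub>2)\<close> plus an error \<open>\<kappa>\<^sub>1 / a\<close>,
  hence bounded away from \<open>0\<close> for large \<open>a\<close>.  To obtain finite mean return times to every single
  state \<open>x\<close>, \<open>V\<close> is corrected by bounded functions so that its drift is negative at all states
  other than \<open>x\<close>.
\<close>

section \<open>Foster's criterion for the mean return time\<close>

definition drive_step :: "('s \<Rightarrow> 's \<Rightarrow> real) \<Rightarrow> (real \<times> ('s \<Rightarrow> 's)) measure" where
  "drive_step q = density lborel (exponential_density 1)
     \<Otimes>\<^sub>M (\<Pi>\<^sub>M x\<in>UNIV. measure_pmf (jump_pmf q x))"

lemma driver_eq: "driver q = (\<Pi>\<^sub>M k\<in>UNIV. drive_step q)"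
  by (simp add: driver_def drive_step_def)

lemma prob_space_exponential: "prob_space (density lborel (exponential_density 1))"
  by (rule prob_space_exponential_density) simp

lemma prob_space_successors: "prob_space (\<Pi>\<^sub>M x\<in>UNIV. measure_pmf (jump_pmf q x))"
  by (intro prob_space_PiM prob_space_measure_pmf)

lemma prob_space_drive_step: "prob_space (drive_step q)"
proof -
  interpret E: prob_space "density lborel (exponential_density 1)"
    by (rule prob_space_exponential)
  interpret J: prob_space "\<Pi>\<^sub>M x\<in>UNIV. measure_pmf (jump_pmf q x)"
    by (rule prob_space_successors)
  interpret pair_prob_space "density lborel (exponential_density 1)"
      "\<Pi>\<^sub>M x\<in>UNIV. measure_pmf (jump_pmf q x)" ..
  show ?thesis
    unfolding drive_step_def by (rule prob_space_axioms)
qed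

text \<open>Prepending an independent step to an i.i.d. sequence leaves its law unchanged. This is
  the form in which the Markov property enters.\<close>

lemma distr_driver_case_nat:
  "distr (drive_step q \<Otimes>\<^sub>M driver q) (driver q) (\<lambda>(s, \<omega>). case_nat s \<omega>) = driver q"
proof -
  interpret M: prob_space "drive_step q" by (rule prob_space_drive_step)
  interpret sequence_space "drive_step q" ..
  show ?thesis
    unfolding driver_eq by (rule PiM_iter)
qed

lemma measurable_case_nat_driver [measurable]:
  "(\<lambda>(s, \<omega>). case_nat s \<omega>) \<in> drive_step q \<Otimes>\<^sub>M driver q \<rightarrow>\<^sub>M driver q"
  unfolding driver_eq by measurable

text \<open>Conditioning on the first step: invariance of \<open>driver q\<close> under prepending,
  followed by Fubini.\<close>

lemma nn_integral_driver_case_nat: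
  assumes f: "f \<in> borel_measurable (driver q)"
  shows "(\<integral>\<^sup>+ \<omega>. f \<omega> \<partial>driver q) =
    (\<integral>\<^sup>+ s. \<integral>\<^sup>+ \<omega>. f (case_nat s \<omega>) \<partial>driver q \<partial>drive_step q)"
proof -
  interpret D: prob_space "driver q" by (rule prob_space_driver)
  have m: "(\<lambda>p. f (case p of (s, \<omega>) \<Rightarrow> case_nat s \<omega>)) \<in> borel_measurable (drive_step q \<Otimes>\<^sub>M driver q)"
    using f by measurable
  have "(\<integral>\<^sup>+ \<omega>. f \<omega> \<partial>driver q) =
      (\<integral>\<^sup>+ \<omega>. f \<omega> \<partial>distr (drive_step q \<Otimes>\<^sub>M driver q) (driver q) (\<lambda>(s, \<omega>). case_nat s \<omega>))"
    by (simp only: distr_driver_case_nat)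
  also have "\<dots> = (\<integral>\<^sup>+ p. f (case p of (s, \<omega>) \<Rightarrow> case_nat s \<omega>) \<partial>(drive_step q \<Otimes>\<^sub>M driver q))"
    by (rule nn_integral_distr) (use f in measurable)
  also have "\<dots> = (\<integral>\<^sup>+ s. \<integral>\<^sup>+ \<omega>. f (case_nat s \<omega>) \<partial>driver q \<partial>drive_step q)"
    using D.nn_integral_fst[OF m] by simp
  finally show ?thesis .
qed

lemma nn_integral_exponential_mean:
  "(\<integral>\<^sup>+ t. ennreal t \<partial>density lborel (exponential_density 1)) = 1"
proof -
  have "(\<integral>\<^sup>+ t. ennreal t \<partial>density lborel (exponential_density 1)) =
      (\<integral>\<^sup>+ t. ennreal (erlang_density 0 1 t * t ^ 1) \<partial>lborel)"
    by (subst nn_integral_density)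
      (auto intro!: nn_integral_cong simp: ennreal_mult'[symmetric] erlang_density_nonneg)
  also have "\<dots> = 1"
    by (subst nn_integral_erlang_ith_moment) auto
  finally show ?thesis .
qed

lemma measurable_successor:
  "(\<lambda>f. f y) \<in> (\<Pi>\<^sub>M x\<in>UNIV. measure_pmf (jump_pmf q x)) \<rightarrow>\<^sub>M measure_pmf (jump_pmf q y)"
  by (rule measurable_component_singleton) simp

lemma nn_integral_drive_step_fst:
  assumes "f \<in> borel_measurable borel"
  shows "(\<integral>\<^sup>+ s. f (fst s) \<partial>drive_step q) = (\<integral>\<^sup>+ t. f t \<partial>density lborel (exponential_density 1))"
proof -
  interpret J: prob_space "\<Pi>\<^sub>M x\<in>UNIV. measure_pmf (jump_pmf q x)"
    by (rule prob_space_successors)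
  show ?thesis
    unfolding drive_step_def using assms
    by (subst J.nn_integral_fst[symmetric]) (auto simp: J.emeasure_space_1)
qed

text \<open>The exponential factor integrates to 1, and the marginal of the product of successors at
  \<open>y\<close> is \<open>jump_pmf q y\<close>.\<close>

lemma nn_integral_drive_step_snd:
  "(\<integral>\<^sup>+ s. g (snd s y) \<partial>drive_step q) = (\<integral>\<^sup>+ z. g z \<partial>measure_pmf (jump_pmf q y))"
proof -
  interpret E: prob_space "density lborel (exponential_density 1)"
    by (rule prob_space_exponential)
  interpret J: prob_space "\<Pi>\<^sub>M x\<in>UNIV. measure_pmf (jump_pmf q x)"
    by (rule prob_space_successors)
  note m = measurable_successor[of y q]
  have "(\<integral>\<^sup>+ s. g (snd s y) \<partial>drive_step q) =
      (\<integral>\<^sup>+ f. g (f y) \<partial>(\<Pi>\<^sub>M x\<in>UNIV. measure_pmf (jump_pmf q x)))"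
    unfolding drive_step_def
    by (subst J.nn_integral_fst[symmetric, OF measurable_compose[OF
          measurable_compose[OF measurable_snd m]]]) (simp_all add: E.emeasure_space_1[simplified])
  also have "\<dots> = (\<integral>\<^sup>+ z. g z \<partial>distr (\<Pi>\<^sub>M x\<in>UNIV. measure_pmf (jump_pmf q x))
      (measure_pmf (jump_pmf q y)) (\<lambda>f. f y))"
    by (rule nn_integral_distr[symmetric]) (use m in auto)
  also have "\<dots> = (\<integral>\<^sup>+ z. g z \<partial>measure_pmf (jump_pmf q y))"
    by (subst distr_PiM_component) (auto intro: prob_space_measure_pmf)
  finally show ?thesis .
qed

text \<open>By \<open>return_time_eq\<close> only visits of positive duration count as returns, so a
  null set of zero holding times has to be discarded.\<close>

lemma AE_driver_fst_pos: "AE \<omega> in driver q. \<forall>k. 0 < fst (\<omega> k)"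
proof -
  interpret J: prob_space "\<Pi>\<^sub>M x\<in>UNIV. measure_pmf (jump_pmf q x)"
    by (rule prob_space_successors)
  have "AE t in lborel. t \<noteq> (0::real)"
    by (rule AE_lborel_singleton)
  then have E: "AE t in density lborel (exponential_density 1). 0 < t"
    by (subst AE_density) (auto simp: erlang_density_def elim!: eventually_mono)
  have "AE s in drive_step q. 0 < fst s"
  proof -
    have "AE s in distr (drive_step q) (density lborel (exponential_density 1)) fst. 0 < s"
      unfolding drive_step_def J.distr_pair_fst by (rule E)
    then show ?thesis
      by (subst (asm) AE_distr_iff) (auto simp: drive_step_def)
  qed
  then have "AE \<omega> in driver q. 0 < fst (\<omega> k)" for k
    unfolding driver_eq by (intro AE_PiM_component) (auto intro: prob_space_drive_step)
  then show ?thesis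
    by (simp add: AE_all_countable)
qed

section \<open>Expected cost of an excursion up to the first return\<close>

lemma jump_chain_case_nat:
  "jump_chain y (case_nat s \<omega>) (Suc k) = jump_chain (snd s y) \<omega> k"
  by (induction k) auto

lemma holding_time_case_nat:
  "holding_time q y (case_nat s \<omega>) (Suc k) = holding_time q (snd s y) \<omega> k"
  unfolding holding_time_def jump_chain_case_nat by simp

lemma measurable_holding_time:
  fixes q :: "'s::countable \<Rightarrow> 's \<Rightarrow> real"
  shows "(\<lambda>\<omega>. holding_time q x \<omega> i) \<in> borel_measurable (driver q)"
proof -
  have "(\<lambda>\<omega>. \<omega> i) \<in> driver q \<rightarrow>\<^sub>M drive_step q"
    unfolding driver_eq by (rule measurable_component_singleton) simp
  then have "(\<lambda>\<omega>. fst (\<omega> i)) \<in> driver q \<rightarrow>\<^sub>M density lborel (exponential_density 1)"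
    unfolding drive_step_def by (rule measurable_compose[OF _ measurable_fst])
  then have [measurable]: "(\<lambda>\<omega>. fst (\<omega> i)) \<in> borel_measurable (driver q)"
    by simp
  have [measurable]: "(\<lambda>\<omega>. exit_rate q (jump_chain x \<omega> i)) \<in> borel_measurable (driver q)"
    by (rule measurable_compose[OF measurable_jump_chain]) simp
  show ?thesis
    unfolding holding_time_def by measurable
qed

text \<open>The summand \<open>1\<close> charges every jump, so that a finite cost forces the return to happen.\<close>

definition excursion_cost ::
    "('s \<Rightarrow> 's \<Rightarrow> real) \<Rightarrow> 's \<Rightarrow> 's \<Rightarrow> (nat \<Rightarrow> real \<times> ('s \<Rightarrow> 's)) \<Rightarrow> nat \<Rightarrow> ennreal" where
  "excursion_cost q x y \<omega> n =
     (\<Sum>i<n. if \<forall>j\<in>{1..i}. jump_chain y \<omega> j \<noteq> x then holding_time q y \<omega> i + 1 else 0)"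

lemma measurable_excursion_cost:
  fixes q :: "'s::countable \<Rightarrow> 's \<Rightarrow> real"
  shows "(\<lambda>\<omega>. excursion_cost q x y \<omega> n) \<in> borel_measurable (driver q)"
proof -
  note [measurable] = measurable_jump_chain measurable_holding_time
  show ?thesis
    unfolding excursion_cost_def by measurable
qed

text \<open>The range \<open>{1..i}\<close> in the cost starts at 1, so the starting state never
  counts as a return. Restarting at the successor would therefore miss a return made by the first
  jump, which is why that case is split off.\<close>

lemma excursion_cost_case_nat:
  "excursion_cost q x y (case_nat s \<omega>) (Suc n) =
     ennreal (fst s) / ennreal (exit_rate q y) + 1 +
     (if snd s y = x then 0 else excursion_cost q x (snd s y) \<omega> n)"
proof -
  have Icc: "{1..Suc i} = insert (1::nat) (Suc ` {1..i})" for i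
    unfolding image_Suc_atLeastAtMost by auto
  have chain: "jump_chain y (case_nat s \<omega>) 1 = snd s y"
    using jump_chain_case_nat[of y s \<omega> 0] by simp
  have P: "(\<forall>j\<in>{1..Suc i}. jump_chain y (case_nat s \<omega>) j \<noteq> x) \<longleftrightarrow>
      snd s y \<noteq> x \<and> (\<forall>j\<in>{1..i}. jump_chain (snd s y) \<omega> j \<noteq> x)" for i
    unfolding Icc ball_insert chain by (simp only: Set.ball_simps(9) jump_chain_case_nat)
  show ?thesis
    unfolding excursion_cost_def sum.lessThan_Suc_shift P holding_time_case_nat
    by (auto simp: holding_time_def)
qed

lemma nn_integral_excursion_cost_Suc:
  fixes q :: "'s::countable \<Rightarrow> 's \<Rightarrow> real"
  assumes pos: "0 < exit_rate q y"
  shows "(\<integral>\<^sup>+ \<omega>. excursion_cost q x y \<omega> (Suc n) \<partial>driver q) =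
    ennreal (1 / exit_rate q y) + 1 +
    (\<integral>\<^sup>+ z. (if z = x then 0 else \<integral>\<^sup>+ \<omega>. excursion_cost q x z \<omega> n \<partial>driver q)
       \<partial>measure_pmf (jump_pmf q y))"
proof -
  interpret D: prob_space "driver q" by (rule prob_space_driver)
  interpret M: prob_space "drive_step q" by (rule prob_space_drive_step)
  note [measurable] = measurable_excursion_cost
  let ?G = "\<lambda>z. if z = x then 0 else \<integral>\<^sup>+ \<omega>. excursion_cost q x z \<omega> n \<partial>driver q"
  have [measurable]: "fst \<in> borel_measurable (drive_step q)"
  proof -
    have "fst \<in> drive_step q \<rightarrow>\<^sub>M density lborel (exponential_density 1)"
      unfolding drive_step_def by (rule measurable_fst)
    then show ?thesis by simp
  qed
  have [measurable]: "(\<lambda>s. snd s y) \<in> drive_step q \<rightarrow>\<^sub>M count_space UNIV"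
  proof -
    have "(\<lambda>f. f y) \<in> (\<Pi>\<^sub>M x\<in>UNIV. measure_pmf (jump_pmf q x)) \<rightarrow>\<^sub>M count_space UNIV"
      using measurable_successor[of y q] by simp
    then show ?thesis
      unfolding drive_step_def by (rule measurable_compose[OF measurable_snd])
  qed
  have [measurable]: "(\<lambda>s. ?G (snd s y)) \<in> borel_measurable (drive_step q)"
    by (rule measurable_compose[where N = "count_space UNIV"]) simp_all
  have "(\<integral>\<^sup>+ \<omega>. excursion_cost q x y \<omega> (Suc n) \<partial>driver q) =
      (\<integral>\<^sup>+ s. \<integral>\<^sup>+ \<omega>. excursion_cost q x y (case_nat s \<omega>) (Suc n) \<partial>driver q \<partial>drive_step q)"
    by (rule nn_integral_driver_case_nat) measurable
  also have "\<dots> = (\<integral>\<^sup>+ s. ennreal (fst s) / ennreal (exit_rate q y) + 1 + ?G (snd s y) \<partial>drive_step q)"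
    unfolding excursion_cost_case_nat
    by (intro nn_integral_cong) (auto simp: nn_integral_add D.emeasure_space_1)
  also have "\<dots> = (\<integral>\<^sup>+ s. ennreal (fst s) / ennreal (exit_rate q y) \<partial>drive_step q) + 1 +
      (\<integral>\<^sup>+ s. ?G (snd s y) \<partial>drive_step q)"
    by (simp add: nn_integral_add M.emeasure_space_1)
  also have "(\<integral>\<^sup>+ s. ennreal (fst s) / ennreal (exit_rate q y) \<partial>drive_step q) =
      ennreal (1 / exit_rate q y)"
    using pos by (simp add: nn_integral_divide nn_integral_drive_step_fst
        nn_integral_exponential_mean divide_ennreal[symmetric] ennreal_1[symmetric] del: ennreal_1)
  also have "(\<integral>\<^sup>+ s. ?G (snd s y) \<partial>drive_step q) = (\<integral>\<^sup>+ z. ?G z \<partial>measure_pmf (jump_pmf q y))"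
    by (rule nn_integral_drive_step_snd)
  finally show ?thesis .
qed

text \<open>The drift condition makes \<open>V\<close> a supersolution of the first-step recursion,
  so induction on the number of jumps gives a bound uniform in \<open>n\<close>. Replacing the value
  at \<open>x\<close> by 0 only helps, since \<open>V\<close> is nonnegative.\<close>

lemma nn_integral_excursion_cost_le:
  fixes q :: "'s::countable \<Rightarrow> 's \<Rightarrow> real"
  assumes pos: "\<And>y. 0 < exit_rate q y"
    and drift: "\<And>y. y \<noteq> x \<Longrightarrow>
      (\<integral>\<^sup>+ z. V z \<partial>measure_pmf (jump_pmf q y)) + ennreal (1 / exit_rate q y) + 1 \<le> V y"
  shows "y \<noteq> x \<Longrightarrow> (\<integral>\<^sup>+ \<omega>. excursion_cost q x y \<omega> n \<partial>driver q) \<le> V y"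
proof (induction n arbitrary: y)
  case 0
  then show ?case by (simp add: excursion_cost_def)
next
  case (Suc n)
  have "(\<integral>\<^sup>+ z. (if z = x then 0 else \<integral>\<^sup>+ \<omega>. excursion_cost q x z \<omega> n \<partial>driver q)
       \<partial>measure_pmf (jump_pmf q y)) \<le> (\<integral>\<^sup>+ z. V z \<partial>measure_pmf (jump_pmf q y))"
    by (intro nn_integral_mono) (auto intro: Suc.IH)
  then have "(\<integral>\<^sup>+ \<omega>. excursion_cost q x y \<omega> (Suc n) \<partial>driver q)
      \<le> ennreal (1 / exit_rate q y) + 1 + (\<integral>\<^sup>+ z. V z \<partial>measure_pmf (jump_pmf q y))"
    unfolding nn_integral_excursion_cost_Suc[OF pos] by (rule add_left_mono)
  also have "\<dots> \<le> V y"
    using drift[OF Suc.prems] by (simp add: add_ac)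
  finally show ?case .
qed

text \<open>A pathwise bound: finite cost forces a first return \<open>T\<close>, and every holding
  time before \<open>T\<close> is included in the cost.\<close>

lemma return_time_le_excursion_cost:
  assumes pos: "\<And>y. 0 < exit_rate q y" and hold: "\<And>k. 0 < fst (\<omega> k)"
    and fin: "(SUP n. excursion_cost q x x \<omega> n) \<noteq> \<infinity>"
  shows "return_time q x \<omega> \<le> (SUP n. excursion_cost q x x \<omega> n)"
proof -
  \<comment> \<open>Without a return the unit charges alone would add up to infinity.\<close>
  have "\<exists>k\<ge>1. jump_chain x \<omega> k = x"
  proof (rule ccontr)
    assume "\<not> ?thesis"
    then have "excursion_cost q x x \<omega> n = (\<Sum>i<n. holding_time q x \<omega> i + 1)" for n
      unfolding excursion_cost_def by (intro sum.cong) auto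
    then have "of_nat n \<le> excursion_cost q x x \<omega> n" for n
      by (simp add: sum.distrib)
    then have "(SUP n. of_nat n :: ennreal) \<le> (SUP n. excursion_cost q x x \<omega> n)"
      by (rule SUP_mono')
    then show False
      using fin by (simp add: ennreal_SUP_of_nat_eq_top top_unique)
  qed
  then obtain k where k: "1 \<le> k \<and> jump_chain x \<omega> k = x" by blast
  define T where "T = (LEAST k. 1 \<le> k \<and> jump_chain x \<omega> k = x)"
  have T: "1 \<le> T" "jump_chain x \<omega> T = x"
    using LeastI[of "\<lambda>k. 1 \<le> k \<and> jump_chain x \<omega> k = x", OF k] unfolding T_def by auto
  have less_T: "jump_chain x \<omega> j \<noteq> x" if "1 \<le> j" "j < T" for j
    using not_less_Least[of j "\<lambda>k. 1 \<le> k \<and> jump_chain x \<omega> k = x"] that unfolding T_def by blast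
  have "jump_time q x \<omega> T \<le> excursion_cost q x x \<omega> T"
    unfolding jump_time_def excursion_cost_def using less_T by (intro sum_mono) auto
  also have "\<dots> \<le> (SUP n. excursion_cost q x x \<omega> n)"
    by (rule SUP_upper) simp
  finally have le: "jump_time q x \<omega> T \<le> (SUP n. excursion_cost q x x \<omega> n)" .
  \<comment> \<open>The visit at \<open>T\<close> must last a positive time. Strictness of the next
    inequality also uses that the jump time is finite, because adding to infinity changes
    nothing.\<close>
  have "0 < holding_time q x \<omega> T"
    unfolding holding_time_def using hold pos
    by (simp add: divide_ennreal less_imp_le)
  moreover have "jump_time q x \<omega> T < \<infinity>"
    using le fin unfolding infinity_ennreal_def less_top by (rule order.strict_trans1)
  ultimately have "jump_time q x \<omega> T < jump_time q x \<omega> (Suc T)"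
    using ennreal_add_left_cancel_less[of "jump_time q x \<omega> T" 0 "holding_time q x \<omega> T"]
    by (simp add: jump_time_def less_top)
  then have "return_time q x \<omega> \<le> jump_time q x \<omega> T"
    unfolding return_time_eq using T by (intro INF_lower) auto
  with le show ?thesis by simp
qed

text \<open>From \<open>x\<close> the first jump is taken explicitly; afterwards the supersolution
  bound applies until the return. Monotone convergence passes to the cost of the whole excursion,
  which dominates the return time almost surely.\<close>

lemma foster_return_time_finite:
  fixes q :: "'s::countable \<Rightarrow> 's \<Rightarrow> real"
  assumes pos: "\<And>y. 0 < exit_rate q y"
    and drift: "\<And>y. y \<noteq> x \<Longrightarrow>
      (\<integral>\<^sup>+ z. V z \<partial>measure_pmf (jump_pmf q y)) + ennreal (1 / exit_rate q y) + 1 \<le> V y"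
    and finite: "(\<integral>\<^sup>+ z. V z \<partial>measure_pmf (jump_pmf q x)) < \<infinity>"
  shows "(\<integral>\<^sup>+ \<omega>. return_time q x \<omega> \<partial>driver q) < \<infinity>"
proof -
  note [measurable] = measurable_excursion_cost
  let ?B = "ennreal (1 / exit_rate q x) + 1 + (\<integral>\<^sup>+ z. V z \<partial>measure_pmf (jump_pmf q x))"
  have inc: "incseq (\<lambda>n \<omega>. excursion_cost q x x \<omega> n)"
    by (intro incseq_SucI) (auto simp: le_fun_def excursion_cost_def)
  have "(\<integral>\<^sup>+ \<omega>. excursion_cost q x x \<omega> (Suc n) \<partial>driver q) \<le> ?B" for n
    unfolding nn_integral_excursion_cost_Suc[OF pos]
    by (intro add_left_mono nn_integral_mono)
      (auto intro: nn_integral_excursion_cost_le[OF pos drift])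
  then have le: "(\<integral>\<^sup>+ \<omega>. excursion_cost q x x \<omega> n \<partial>driver q) \<le> ?B" for n
    by (cases n) (auto simp: excursion_cost_def[of _ _ _ _ 0])
  have "(\<integral>\<^sup>+ \<omega>. (SUP n. excursion_cost q x x \<omega> n) \<partial>driver q) =
      (SUP n. \<integral>\<^sup>+ \<omega>. excursion_cost q x x \<omega> n \<partial>driver q)"
    by (rule nn_integral_monotone_convergence_SUP[OF inc]) measurable
  also have "\<dots> \<le> ?B"
    by (intro SUP_least le)
  also have "\<dots> < \<infinity>"
    using finite by simp
  finally have fin: "(\<integral>\<^sup>+ \<omega>. (SUP n. excursion_cost q x x \<omega> n) \<partial>driver q) < \<infinity>" .
  then have "AE \<omega> in driver q. (SUP n. excursion_cost q x x \<omega> n) \<noteq> \<infinity>"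
    by (intro nn_integral_PInf_AE) auto
  with AE_driver_fst_pos[of q]
  have "AE \<omega> in driver q. return_time q x \<omega> \<le> (SUP n. excursion_cost q x x \<omega> n)"
    by eventually_elim (rule return_time_le_excursion_cost[OF pos]; blast)
  then have "(\<integral>\<^sup>+ \<omega>. return_time q x \<omega> \<partial>driver q)
      \<le> (\<integral>\<^sup>+ \<omega>. (SUP n. excursion_cost q x x \<omega> n) \<partial>driver q)"
    by (rule nn_integral_mono_AE)
  then show ?thesis
    using fin by (rule order.strict_trans1)
qed


section \<open>Lyapunov functions for controls\<close>

text \<open>This is the generator of the process applied to \<open>V\<close>. On the axes truncated
  subtraction makes the downward increment zero.\<close>

definition drift ::
    "real \<Rightarrow> real \<Rightarrow> real \<Rightarrow> real \<Rightarrow> (state \<Rightarrow> real \<times> real) \<Rightarrow> (state \<Rightarrow> real) \<Rightarrow> state \<Rightarrow> real" where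
  "drift \<nu>1 \<nu>2 \<mu>1 \<mu>2 b V n =
     \<nu>1 * (V (fst n + 1, snd n) - V n) + \<nu>2 * (V (fst n, snd n + 1) - V n) +
     \<mu>1 * fst (b n) * (V (fst n - 1, snd n) - V n) +
     \<mu>2 * snd (b n) * (V (fst n, snd n - 1) - V n)"

lemma drift_add_scaled:
  "drift \<nu>1 \<nu>2 \<mu>1 \<mu>2 b (\<lambda>m. V m + K * W m) n =
     drift \<nu>1 \<nu>2 \<mu>1 \<mu>2 b V n + K * drift \<nu>1 \<nu>2 \<mu>1 \<mu>2 b W n"
  by (simp add: drift_def algebra_simps)

text \<open>Adding the diagonal term back to the generator leaves the rate-weighted sum of
  \<open>V\<close> over the successors. A departure from an empty class contributes nothing, as its
  rate vanishes.\<close>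

lemma has_sum_call_rate_times:
  assumes "is_control b"
  shows "((\<lambda>m. call_rate \<nu>1 \<nu>2 \<mu>1 \<mu>2 b n m * V m) has_sum
     (drift \<nu>1 \<nu>2 \<mu>1 \<mu>2 b V n + (\<nu>1 + \<nu>2 + \<mu>1 * fst (b n) + \<mu>2 * snd (b n)) * V n)) UNIV"
proof -
  have single: "((\<lambda>m. if m = u then c * V m else 0) has_sum c * V u) UNIV" for u :: state and c :: real
    using has_sum_finite_neutralI[of "{u}" UNIV "\<lambda>m. if m = u then c * V m else 0" "c * V u"] by simp
  have dep1: "((\<lambda>m. if n = (fst m + 1, snd m) then \<mu>1 * fst (b n) * V m else 0)
      has_sum \<mu>1 * fst (b n) * V (fst n - 1, snd n)) UNIV"
  proof (cases "fst n = 0")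
    case True
    then have "fst (b n) = 0" using assms unfolding is_control_def by blast
    then show ?thesis using single[of n 0] by (simp only: mult_zero_right mult_zero_left if_cancel)
  next
    case False
    then have "(n = (fst m + 1, snd m)) = (m = (fst n - 1, snd n))" for m
      by (cases n; cases m) auto
    then show ?thesis using single[of "(fst n - 1, snd n)" "\<mu>1 * fst (b n)"] by simp
  qed
  have dep2: "((\<lambda>m. if n = (fst m, snd m + 1) then \<mu>2 * snd (b n) * V m else 0)
      has_sum \<mu>2 * snd (b n) * V (fst n, snd n - 1)) UNIV"
  proof (cases "snd n = 0")
    case True
    then have "snd (b n) = 0" using assms unfolding is_control_def by blast
    then show ?thesis using single[of n 0] by (simp only: mult_zero_right mult_zero_left if_cancel)
  next
    case False
    then have "(n = (fst m, snd m + 1)) = (m = (fst n, snd n - 1))" for m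
      by (cases n; cases m) auto
    then show ?thesis using single[of "(fst n, snd n - 1)" "\<mu>2 * snd (b n)"] by simp
  qed
  have "call_rate \<nu>1 \<nu>2 \<mu>1 \<mu>2 b n m * V m =
     (if m = (fst n + 1, snd n) then \<nu>1 * V m else 0) +
     (if m = (fst n, snd n + 1) then \<nu>2 * V m else 0) +
     (if n = (fst m + 1, snd m) then \<mu>1 * fst (b n) * V m else 0) +
     (if n = (fst m, snd m + 1) then \<mu>2 * snd (b n) * V m else 0)" for m
    unfolding call_rate_def by (simp only: distrib_right if_distribR mult_zero_left)
      (simp add: if_distrib[of "\<lambda>c. c * V m"])
  moreover have "drift \<nu>1 \<nu>2 \<mu>1 \<mu>2 b V n + (\<nu>1 + \<nu>2 + \<mu>1 * fst (b n) + \<mu>2 * snd (b n)) * V n =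
     \<nu>1 * V (fst n + 1, snd n) + \<nu>2 * V (fst n, snd n + 1) +
     \<mu>1 * fst (b n) * V (fst n - 1, snd n) + \<mu>2 * snd (b n) * V (fst n, snd n - 1)"
    by (simp add: drift_def algebra_simps)
  ultimately show ?thesis
    by (simp only:) (intro has_sum_add single dep1 dep2)
qed

section \<open>Mean change of a function over one jump\<close>

lemma nn_integral_count_space_has_sum:
  fixes f :: "'s \<Rightarrow> real"
  assumes hs: "(f has_sum s) UNIV" and nonneg: "\<And>x. 0 \<le> f x"
  shows "(\<integral>\<^sup>+ x. ennreal (f x) \<partial>count_space UNIV) = ennreal s"
proof -
  have "f summable_on UNIV"
    using hs unfolding summable_on_def by blast
  then have asum: "Infinite_Set_Sum.abs_summable_on f UNIV"
    using summable_on_iff_abs_summable_on_real abs_summable_equivalent by metis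
  then have "integrable (count_space UNIV) f"
    by (simp only: Infinite_Set_Sum.abs_summable_on_def)
  then have "(\<integral>\<^sup>+ x. ennreal (f x) \<partial>count_space UNIV) = ennreal (infsetsum f UNIV)"
    unfolding infsetsum_def using nonneg by (intro nn_integral_eq_integral) auto
  then show ?thesis
    using infsetsum_infsum[OF asum] infsumI[OF hs] by simp
qed

lemma nn_integral_jump_pmf_call_rate:
  assumes b: "is_control b" and pos: "0 < \<nu>1" "0 < \<nu>2" "0 < \<mu>1" "0 < \<mu>2"
    and V: "\<And>m. 0 \<le> V m"
  shows "(\<integral>\<^sup>+ m. ennreal (V m) \<partial>measure_pmf (jump_pmf (call_rate \<nu>1 \<nu>2 \<mu>1 \<mu>2 b) n)) =
    ennreal (V n + drift \<nu>1 \<nu>2 \<mu>1 \<mu>2 b V n / (\<nu>1 + \<nu>2 + \<mu>1 * fst (b n) + \<mu>2 * snd (b n)))"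
proof -
  let ?r = "\<nu>1 + \<nu>2 + \<mu>1 * fst (b n) + \<mu>2 * snd (b n)"
  let ?f = "\<lambda>m. call_rate \<nu>1 \<nu>2 \<mu>1 \<mu>2 b n m * V m / ?r"
  have "0 \<le> fst (b n)" "0 \<le> snd (b n)"
    using b unfolding is_control_def by blast+
  then have r: "0 < ?r" and rate: "0 \<le> call_rate \<nu>1 \<nu>2 \<mu>1 \<mu>2 b n m" for m
    using pos by (auto simp: call_rate_def intro!: add_nonneg_nonneg add_pos_nonneg)
  have f: "0 \<le> ?f m" for m
    using r rate V by simp
  have "(?f has_sum ((drift \<nu>1 \<nu>2 \<mu>1 \<mu>2 b V n + ?r * V n) / ?r)) UNIV"
    using has_sum_cmult_left[OF has_sum_call_rate_times[OF b], where c = "inverse ?r"]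
    by (simp only: divide_inverse)
  also have "(drift \<nu>1 \<nu>2 \<mu>1 \<mu>2 b V n + ?r * V n) / ?r = V n + drift \<nu>1 \<nu>2 \<mu>1 \<mu>2 b V n / ?r"
    using r by (simp add: add_divide_distrib)
  finally have hs: "(?f has_sum (V n + drift \<nu>1 \<nu>2 \<mu>1 \<mu>2 b V n / ?r)) UNIV" .
  have "(\<integral>\<^sup>+ m. ennreal (V m) \<partial>measure_pmf (jump_pmf (call_rate \<nu>1 \<nu>2 \<mu>1 \<mu>2 b) n)) =
      (\<integral>\<^sup>+ m. ennreal (?f m) \<partial>count_space UNIV)"
    unfolding nn_integral_measure_pmf pmf_jump_pmf_call_rate[OF b pos]
    using r rate V by (intro nn_integral_cong) (simp flip: ennreal_mult')
  also have "\<dots> = ennreal (V n + drift \<nu>1 \<nu>2 \<mu>1 \<mu>2 b V n / ?r)"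
    by (rule nn_integral_count_space_has_sum[OF hs f])
  finally show ?thesis .
qed

text \<open>Negative drift is asked for at all states but one, rather than off a finite set, so that
  the criterion bounds the return time to exactly that state.\<close>

definition lyapunov_at ::
    "real \<Rightarrow> real \<Rightarrow> real \<Rightarrow> real \<Rightarrow> (state \<Rightarrow> real \<times> real) \<Rightarrow> state \<Rightarrow> bool" where
  "lyapunov_at \<nu>1 \<nu>2 \<mu>1 \<mu>2 b x \<longleftrightarrow>
     (\<exists>V \<gamma>. 0 < \<gamma> \<and> (\<forall>n. 0 \<le> V n) \<and> (\<forall>n. n \<noteq> x \<longrightarrow> drift \<nu>1 \<nu>2 \<mu>1 \<mu>2 b V n \<le> - \<gamma>))"

lemma lyapunov_at_imp_return_time_finite:
  assumes b: "is_control b" and pos: "0 < \<nu>1" "0 < \<nu>2" "0 < \<mu>1" "0 < \<mu>2"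
    and R: "\<And>n. \<nu>1 + \<nu>2 + \<mu>1 * fst (b n) + \<mu>2 * snd (b n) \<le> R"
    and lyap: "lyapunov_at \<nu>1 \<nu>2 \<mu>1 \<mu>2 b x"
  shows "(\<integral>\<^sup>+ \<omega>. return_time (call_rate \<nu>1 \<nu>2 \<mu>1 \<mu>2 b) x \<omega>
    \<partial>driver (call_rate \<nu>1 \<nu>2 \<mu>1 \<mu>2 b)) < \<infinity>"
proof -
  let ?r = "\<lambda>n. \<nu>1 + \<nu>2 + \<mu>1 * fst (b n) + \<mu>2 * snd (b n)"
  obtain V0 \<gamma> where \<gamma>: "0 < \<gamma>" and V0: "\<And>n. 0 \<le> V0 n"
    and D0: "\<And>n. n \<noteq> x \<Longrightarrow> drift \<nu>1 \<nu>2 \<mu>1 \<mu>2 b V0 n \<le> - \<gamma>"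
    using lyap unfolding lyapunov_at_def by blast
  have r: "0 < ?r n" for n
  proof -
    have "0 \<le> fst (b n)" "0 \<le> snd (b n)"
      using b unfolding is_control_def by blast+
    then show ?thesis
      using pos by (auto intro!: add_nonneg_nonneg add_pos_nonneg)
  qed
  then have R0: "0 < R" using R order_less_le_trans by blast
  \<comment> \<open>The scaling brings the drift below -(1 + R). Divided by an exit rate r \<le> R
    this is at most -1/r - 1, which pays for the mean holding time and the unit charge.\<close>
  define V where "V n = (1 + R) / \<gamma> * V0 n" for n
  have V: "0 \<le> V n" for n
    unfolding V_def using V0 \<gamma> R0 by simp
  have D: "drift \<nu>1 \<nu>2 \<mu>1 \<mu>2 b V n \<le> - (1 + R)" if "n \<noteq> x" for n
  proof -
    have "drift \<nu>1 \<nu>2 \<mu>1 \<mu>2 b V n = (1 + R) / \<gamma> * drift \<nu>1 \<nu>2 \<mu>1 \<mu>2 b V0 n"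
      unfolding V_def drift_def by (simp only: right_diff_distrib distrib_left mult_ac)
    also have "\<dots> \<le> (1 + R) / \<gamma> * - \<gamma>"
      using D0[OF that] \<gamma> R0 by (intro mult_left_mono) auto
    finally show ?thesis using \<gamma> by simp
  qed
  note J = nn_integral_jump_pmf_call_rate[OF b pos, of V, OF V]
  show ?thesis
  proof (rule foster_return_time_finite[where V = "\<lambda>n. ennreal (V n)"])
    show "0 < exit_rate (call_rate \<nu>1 \<nu>2 \<mu>1 \<mu>2 b) y" for y
      unfolding exit_rate_call_rate[OF b] by (rule r)
  next
    fix y assume y: "y \<noteq> x"
    have "drift \<nu>1 \<nu>2 \<mu>1 \<mu>2 b V y / ?r y \<le> - (1 + ?r y) / ?r y"
      using D[OF y] R[of y] r[of y] by (intro divide_right_mono) auto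
    also have "\<dots> = - 1 / ?r y - 1"
      using r[of y] by (simp add: field_simps)
    finally have le: "V y + drift \<nu>1 \<nu>2 \<mu>1 \<mu>2 b V y / ?r y + 1 / ?r y + 1 \<le> V y"
      by simp
    let ?u = "V y + drift \<nu>1 \<nu>2 \<mu>1 \<mu>2 b V y / ?r y"
    show "(\<integral>\<^sup>+ z. ennreal (V z) \<partial>measure_pmf (jump_pmf (call_rate \<nu>1 \<nu>2 \<mu>1 \<mu>2 b) y)) +
        ennreal (1 / exit_rate (call_rate \<nu>1 \<nu>2 \<mu>1 \<mu>2 b) y) + 1 \<le> ennreal (V y)"
    proof -
      \<comment> \<open>Since \<open>ennreal\<close> truncates negative numbers, sums can be merged
        only for nonnegative terms; here \<open>?u\<close> is a mean of the nonnegative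
        \<open>V\<close> after one jump.\<close>
      have "0 \<le> ?u"
      proof -
        have hs: "((\<lambda>m. call_rate \<nu>1 \<nu>2 \<mu>1 \<mu>2 b y m * V m) has_sum
            (drift \<nu>1 \<nu>2 \<mu>1 \<mu>2 b V y + ?r y * V y)) UNIV"
          by (rule has_sum_call_rate_times[OF b])
        have "0 \<le> drift \<nu>1 \<nu>2 \<mu>1 \<mu>2 b V y + ?r y * V y"
          by (rule has_sum_nonneg[OF hs])
            (use b pos V in \<open>auto simp: call_rate_def is_control_def intro!: mult_nonneg_nonneg add_nonneg_nonneg\<close>)
        then have "0 \<le> (drift \<nu>1 \<nu>2 \<mu>1 \<mu>2 b V y + ?r y * V y) / ?r y"
          using r[of y] by simp
        then show ?thesis
          using r[of y] by (simp add: add_divide_distrib add.commute)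
      qed
      then have "ennreal ?u + ennreal (1 / ?r y) + 1 = ennreal (?u + 1 / ?r y + 1)"
        using r[of y] by (simp add: ennreal_plus del: ennreal_plus flip: ennreal_plus ennreal_1)
      also have "\<dots> \<le> ennreal (V y)"
        using le by (rule ennreal_leI)
      finally show ?thesis
        unfolding J exit_rate_call_rate[OF b] .
    qed
  next
    show "(\<integral>\<^sup>+ z. ennreal (V z) \<partial>measure_pmf (jump_pmf (call_rate \<nu>1 \<nu>2 \<mu>1 \<mu>2 b) x)) < \<infinity>"
      unfolding J by simp
  qed
qed

text \<open>If \<open>x\<close> jumps to \<open>z\<close>, adding a large multiple of the indicator of the complement of \<open>z\<close>
  makes the drift negative at \<open>x\<close> and increases it only at \<open>z\<close>.\<close>

lemma lyapunov_at_birth: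
  assumes b: "is_control b" and pos: "0 < \<nu>1" "0 < \<nu>2" "0 < \<mu>1" "0 < \<mu>2"
    and lyap: "lyapunov_at \<nu>1 \<nu>2 \<mu>1 \<mu>2 b x"
    and z: "z = (fst x + 1, snd x) \<or> z = (fst x, snd x + 1)"
  shows "lyapunov_at \<nu>1 \<nu>2 \<mu>1 \<mu>2 b z"
proof -
  obtain V \<gamma> where \<gamma>: "0 < \<gamma>" and V: "\<And>n. 0 \<le> V n"
    and D: "\<And>n. n \<noteq> x \<Longrightarrow> drift \<nu>1 \<nu>2 \<mu>1 \<mu>2 b V n \<le> - \<gamma>"
    using lyap unfolding lyapunov_at_def by blast
  have b0: "0 \<le> fst (b n)" "0 \<le> snd (b n)" for n
    using b unfolding is_control_def by blast+
  define W :: "state \<Rightarrow> real" where "W n = of_bool (n \<noteq> z)" for n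
  \<comment> \<open>A lower bound for the rate of the jump from \<open>x\<close> to
    \<open>z\<close>. The multiple \<open>K\<close> is then just large enough to cancel the drift of
    \<open>V\<close> at \<open>x\<close> and leave -\<gamma>.\<close>
  define p where "p = min \<nu>1 \<nu>2"
  have p: "0 < p" using pos by (simp add: p_def)
  define K where "K = (\<bar>drift \<nu>1 \<nu>2 \<mu>1 \<mu>2 b V x\<bar> + \<gamma>) / p"
  have K: "0 \<le> K" "K * p = \<bar>drift \<nu>1 \<nu>2 \<mu>1 \<mu>2 b V x\<bar> + \<gamma>"
    using p \<gamma> by (auto simp: K_def)
  have W_diff: "W m - W n \<le> 0" if "n \<noteq> z" for m n
    using that by (simp add: W_def)
  have W0: "drift \<nu>1 \<nu>2 \<mu>1 \<mu>2 b W n \<le> 0" if "n \<noteq> z" for n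
    unfolding drift_def using pos b0[of n] W_diff[OF that]
    by (intro add_nonpos_nonpos mult_nonneg_nonpos mult_nonneg_nonneg) auto
  have xz: "x \<noteq> z" using z by (cases x) auto
  have Wx: "drift \<nu>1 \<nu>2 \<mu>1 \<mu>2 b W x \<le> - p"
  proof -
    have "\<nu>1 * (W (fst x + 1, snd x) - W x) + \<nu>2 * (W (fst x, snd x + 1) - W x) \<le> - p"
      using z xz pos by (auto simp: W_def p_def)
    moreover have "\<mu>1 * fst (b x) * (W (fst x - 1, snd x) - W x) \<le> 0"
      "\<mu>2 * snd (b x) * (W (fst x, snd x - 1) - W x) \<le> 0"
      using pos b0[of x] W_diff[OF xz] by (intro mult_nonneg_nonpos mult_nonneg_nonneg; auto)+
    ultimately show ?thesis unfolding drift_def by linarith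
  qed
  have "drift \<nu>1 \<nu>2 \<mu>1 \<mu>2 b (\<lambda>m. V m + K * W m) n \<le> - \<gamma>" if "n \<noteq> z" for n
  proof (cases "n = x")
    case True
    have "K * drift \<nu>1 \<nu>2 \<mu>1 \<mu>2 b W x \<le> K * - p"
      using Wx K by (intro mult_left_mono) auto
    then show ?thesis
      unfolding drift_add_scaled True using K by simp
  next
    case False
    then show ?thesis
      unfolding drift_add_scaled using D[OF False] mult_nonneg_nonpos[OF K(1) W0[OF that]] by linarith
  qed
  moreover have "0 \<le> V n + K * W n" for n
    using V K by (simp add: W_def)
  ultimately show ?thesis
    unfolding lyapunov_at_def using \<gamma>
    by (intro exI[of _ "\<lambda>m. V m + K * W m"] exI[of _ \<gamma>] conjI allI impI) simp_all
qed

text \<open>Every state is reached from the origin by arrivals, whose rates are positive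
  everywhere.\<close>

lemma lyapunov_at_all:
  assumes b: "is_control b" and pos: "0 < \<nu>1" "0 < \<nu>2" "0 < \<mu>1" "0 < \<mu>2"
    and lyap: "lyapunov_at \<nu>1 \<nu>2 \<mu>1 \<mu>2 b (0, 0)"
  shows "lyapunov_at \<nu>1 \<nu>2 \<mu>1 \<mu>2 b (i, j)"
proof (induction i)
  case 0
  show ?case
    by (induction j) (auto intro: lyap lyapunov_at_birth[OF b pos])
next
  case (Suc i)
  then show ?case
    by (rule lyapunov_at_birth[OF b pos]) simp
qed

section \<open>Correcting the drift on a finite set\<close>

lemma departure_rate_ge:
  assumes b: "is_control b" and pareto: "pareto_efficient c1 c2 b" and c: "c2 \<le> c1"
    and n: "n \<noteq> (0, 0)"
  shows "c2 \<le> fst (b n) + snd (b n)"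
proof -
  have "0 \<le> fst (b n)" "0 \<le> snd (b n)"
    using b unfolding is_control_def by blast+
  \<comment> \<open>Away from the origin some class is nonempty, so Pareto efficiency saturates one
    of the resources.\<close>
  moreover have "fst (b n) + snd (b n) = c1 \<or> snd (b n) = c2"
    using pareto n unfolding pareto_efficient_def saturated1_def saturated2_def
    by (cases n) (metis fst_conv snd_conv gr0I)
  ultimately show ?thesis
    using c by auto
qed

text \<open>For small \<open>\<rho>\<close> the bounded function \<open>\<lambda>n. \<rho> ^ (fst n + snd n)\<close> has positive drift at every state
  but the origin, so it can correct \<open>V\<close> on the finite set without spoiling the drift elsewhere.\<close>

lemma lyapunov_at_origin:
  assumes b: "is_control b" and pareto: "pareto_efficient c1 c2 b" and c: "0 < c2" "c2 \<le> c1"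
    and pos: "0 < \<nu>1" "0 < \<nu>2" "0 < \<mu>1" "0 < \<mu>2"
    and F: "finite F" and \<gamma>: "0 < \<gamma>" and V: "\<And>n. 0 \<le> V n"
    and D: "\<And>n. n \<notin> F \<Longrightarrow> drift \<nu>1 \<nu>2 \<mu>1 \<mu>2 b V n \<le> - \<gamma>"
  shows "lyapunov_at \<nu>1 \<nu>2 \<mu>1 \<mu>2 b (0, 0)"
proof -
  \<comment> \<open>A lower bound for the total departure rate away from the origin. The choice of
    \<rho> keeps the arrival term (\<nu>1 + \<nu>2) \<rho> at most d / 2.\<close>
  define d where "d = min \<mu>1 \<mu>2 * c2"
  have d: "0 < d" using pos c by (simp add: d_def)
  define \<rho> where "\<rho> = min (1 / 2) (d / (2 * (\<nu>1 + \<nu>2)))"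
  have \<rho>: "0 < \<rho>" "\<rho> < 1" and \<rho>d: "(\<nu>1 + \<nu>2) * \<rho> < d"
  proof -
    show "0 < \<rho>" "\<rho> < 1" using d pos by (auto simp: \<rho>_def)
    have "(\<nu>1 + \<nu>2) * \<rho> \<le> (\<nu>1 + \<nu>2) * (d / (2 * (\<nu>1 + \<nu>2)))"
      unfolding \<rho>_def using pos by (intro mult_left_mono) auto
    also have "\<dots> = d / 2" using pos by (simp add: field_simps)
    finally show "(\<nu>1 + \<nu>2) * \<rho> < d" using d by simp
  qed
  \<comment> \<open>Subtracting the power from 1 turns positive drift into negative drift while
    keeping the correction nonnegative.\<close>
  define W where "W n = 1 - \<rho> ^ (fst n + snd n)" for n :: state
  have W: "0 \<le> W n" for n
    using \<rho> by (simp add: W_def power_le_one)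
  have DW: "drift \<nu>1 \<nu>2 \<mu>1 \<mu>2 b W n < 0" if n: "n \<noteq> (0, 0)" for n
  proof -
    have b0: "0 \<le> fst (b n)" "0 \<le> snd (b n)"
      and b1: "fst n = 0 \<longrightarrow> fst (b n) = 0" and b2: "snd n = 0 \<longrightarrow> snd (b n) = 0"
      using b unfolding is_control_def by blast+
    obtain k where k: "fst n + snd n = Suc k"
      using n by (cases n) (metis add_eq_0_iff_both_eq_0 fst_conv snd_conv not0_implies_Suc)
    have "\<mu>1 * fst (b n) * (W (fst n - 1, snd n) - W n) = - (\<mu>1 * fst (b n) * (\<rho> ^ k * (1 - \<rho>)))"
    proof (cases "fst n = 0")
      case False
      then have "fst n - 1 + snd n = k" using k by simp
      then show ?thesis unfolding W_def using k by (simp add: algebra_simps)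
    qed (simp add: b1)
    moreover have "\<mu>2 * snd (b n) * (W (fst n, snd n - 1) - W n) = - (\<mu>2 * snd (b n) * (\<rho> ^ k * (1 - \<rho>)))"
    proof (cases "snd n = 0")
      case False
      then have "fst n + (snd n - 1) = k" using k by simp
      then show ?thesis unfolding W_def using k by (simp add: algebra_simps)
    qed (simp add: b2)
    moreover have "\<nu>1 * (W (fst n + 1, snd n) - W n) + \<nu>2 * (W (fst n, snd n + 1) - W n) =
        (\<nu>1 + \<nu>2) * \<rho> * (\<rho> ^ k * (1 - \<rho>))"
      unfolding W_def using k by (simp add: algebra_simps)
    ultimately have eq: "drift \<nu>1 \<nu>2 \<mu>1 \<mu>2 b W n =
        ((\<nu>1 + \<nu>2) * \<rho> - (\<mu>1 * fst (b n) + \<mu>2 * snd (b n))) * (\<rho> ^ k * (1 - \<rho>))"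
      unfolding drift_def by (simp only: left_diff_distrib distrib_right)
    have "d \<le> min \<mu>1 \<mu>2 * (fst (b n) + snd (b n))"
      unfolding d_def using departure_rate_ge[OF b pareto c(2) n] pos by (intro mult_left_mono) auto
    also have "\<dots> \<le> \<mu>1 * fst (b n) + \<mu>2 * snd (b n)"
      unfolding distrib_left using b0 by (intro add_mono mult_right_mono) auto
    finally show ?thesis
      unfolding eq using \<rho> \<rho>d by (intro mult_neg_pos) auto
  qed
  \<comment> \<open>One multiple serves finitely many states: where \<open>W\<close> has negative
    drift, enlarging \<open>K\<close> only lowers the sum, so the maximum of the individual
    requirements works.\<close>
  have "\<exists>K\<ge>0. \<forall>n\<in>G. drift \<nu>1 \<nu>2 \<mu>1 \<mu>2 b V n + K * drift \<nu>1 \<nu>2 \<mu>1 \<mu>2 b W n \<le> - \<gamma>"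
    if "finite G" "(0, 0) \<notin> G" for G
    using that
  proof (induction G rule: finite_induct)
    case empty
    show ?case by (intro exI[of _ 0]) simp
  next
    case (insert m G)
    then obtain K where K: "K \<ge> 0"
      "\<And>n. n \<in> G \<Longrightarrow> drift \<nu>1 \<nu>2 \<mu>1 \<mu>2 b V n + K * drift \<nu>1 \<nu>2 \<mu>1 \<mu>2 b W n \<le> - \<gamma>"
      by auto
    define L where "L = max K ((drift \<nu>1 \<nu>2 \<mu>1 \<mu>2 b V m + \<gamma>) / - drift \<nu>1 \<nu>2 \<mu>1 \<mu>2 b W m)"
    have "m \<noteq> (0, 0)" using insert.prems by auto
    then have Wm: "drift \<nu>1 \<nu>2 \<mu>1 \<mu>2 b W m < 0" by (rule DW)
    have "L \<ge> (drift \<nu>1 \<nu>2 \<mu>1 \<mu>2 b V m + \<gamma>) / - drift \<nu>1 \<nu>2 \<mu>1 \<mu>2 b W m"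
      by (simp add: L_def)
    then have "drift \<nu>1 \<nu>2 \<mu>1 \<mu>2 b V m + \<gamma> \<le> L * - drift \<nu>1 \<nu>2 \<mu>1 \<mu>2 b W m"
      using Wm by (subst (asm) pos_divide_le_eq) auto
    moreover have "drift \<nu>1 \<nu>2 \<mu>1 \<mu>2 b V n + L * drift \<nu>1 \<nu>2 \<mu>1 \<mu>2 b W n \<le> - \<gamma>" if "n \<in> G" for n
    proof -
      have "n \<noteq> (0, 0)" using that insert.prems by auto
      then have "L * drift \<nu>1 \<nu>2 \<mu>1 \<mu>2 b W n \<le> K * drift \<nu>1 \<nu>2 \<mu>1 \<mu>2 b W n"
        using DW[of n] by (intro mult_right_mono_neg) (auto simp: L_def)
      with K(2)[OF that] show ?thesis by linarith
    qed
    ultimately show ?case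
      using K(1) by (intro exI[of _ L]) (auto simp: L_def)
  qed
  from this[of "F - {(0, 0)}"] F obtain K where K: "K \<ge> 0"
    "\<And>n. n \<in> F - {(0, 0)} \<Longrightarrow> drift \<nu>1 \<nu>2 \<mu>1 \<mu>2 b V n + K * drift \<nu>1 \<nu>2 \<mu>1 \<mu>2 b W n \<le> - \<gamma>"
    by auto
  have "drift \<nu>1 \<nu>2 \<mu>1 \<mu>2 b (\<lambda>m. V m + K * W m) n \<le> - \<gamma>" if n: "n \<noteq> (0, 0)" for n
  proof (cases "n \<in> F")
    case True
    then show ?thesis unfolding drift_add_scaled using K(2) n by blast
  next
    case False
    have "K * drift \<nu>1 \<nu>2 \<mu>1 \<mu>2 b W n \<le> 0"
      using K(1) DW[OF n] by (intro mult_nonneg_nonpos) auto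
    then show ?thesis unfolding drift_add_scaled using D[OF False] by linarith
  qed
  moreover have "0 \<le> V n + K * W n" for n
    using V W K(1) by simp
  ultimately show ?thesis
    unfolding lyapunov_at_def using \<gamma>
    by (intro exI[of _ "\<lambda>m. V m + K * W m"] exI[of _ \<gamma>] conjI allI impI) simp_all
qed

text \<open>Feasibility bounds both components of the control by \<open>c1\<close>, which gives the
  uniform rate bound needed for the scaling; the Lyapunov property is carried from the origin to
  every state.\<close>

lemma stable_control_if_drift_negative_off_finite:
  assumes b: "is_control b" and pareto: "pareto_efficient c1 c2 b" and c: "0 < c2" "c2 \<le> c1"
    and pos: "0 < \<nu>1" "0 < \<nu>2" "0 < \<mu>1" "0 < \<mu>2"
    and F: "finite F" and \<gamma>: "0 < \<gamma>" and V: "\<And>n. 0 \<le> V n"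
    and D: "\<And>n. n \<notin> F \<Longrightarrow> drift \<nu>1 \<nu>2 \<mu>1 \<mu>2 b V n \<le> - \<gamma>"
  shows "stable_control \<nu>1 \<nu>2 \<mu>1 \<mu>2 b"
proof -
  have "\<nu>1 + \<nu>2 + \<mu>1 * fst (b n) + \<mu>2 * snd (b n) \<le> \<nu>1 + \<nu>2 + \<mu>1 * c1 + \<mu>2 * c1" for n
  proof -
    have "0 \<le> fst (b n)" "0 \<le> snd (b n)"
      using b unfolding is_control_def by blast+
    moreover have "fst (b n) + snd (b n) \<le> c1"
      using pareto unfolding pareto_efficient_def feasible_def by blast
    ultimately show ?thesis
      using pos by (intro add_mono mult_left_mono) auto
  qed
  moreover have "lyapunov_at \<nu>1 \<nu>2 \<mu>1 \<mu>2 b x" for x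
    using lyapunov_at_all[OF b pos lyapunov_at_origin[OF b pareto c pos F \<gamma> V D]]
    by (cases x) blast
  ultimately show ?thesis
    unfolding stable_control_def positive_recurrent_def
    using lyapunov_at_imp_return_time_finite[OF b pos] by blast
qed

theorem mainTheorem2:
  fixes \<nu>1 \<nu>2 \<mu>1 \<mu>2 \<kappa>1 \<kappa>2 c1 c2 \<delta> :: real
  assumes "\<nu>1 > 0" "\<nu>2 > 0" "\<mu>1 > 0" "\<mu>2 > 0"
    and "\<kappa>1 = \<nu>1 / \<mu>1" "\<kappa>2 = \<nu>2 / \<mu>2"
    and "0 < c2" "c2 \<le> c1"
    and "\<kappa>1 + \<kappa>2 < c1" "\<kappa>2 < c2"
    and "\<delta> > 0"
  shows "\<exists>a::nat. a \<ge> 1 \<and>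
    (\<forall>b. is_control b \<and> pareto_efficient c1 c2 b \<and>
         (\<exists>F. finite F \<and> (\<forall>n. fst n < a \<and> n \<notin> F \<longrightarrow> \<kappa>2 - snd (b n) \<le> - \<delta>))
       \<longrightarrow> stable_control \<nu>1 \<nu>2 \<mu>1 \<mu>2 b)"
proof -
  \<comment> \<open>The smaller of the two decay rates: that of type 2 near the axis and that of the
    workload.\<close>
  define \<epsilon> where "\<epsilon> = min \<delta> (c1 - \<kappa>1 - \<kappa>2)"
  have \<epsilon>: "0 < \<epsilon>" "\<epsilon> \<le> \<delta>" "\<epsilon> \<le> c1 - \<kappa>1 - \<kappa>2"
    using assms by (auto simp: \<epsilon>_def)
  have \<kappa>1: "0 < \<kappa>1" using assms by simp
  \<comment> \<open>Large enough that the interpolation error \<kappa>1 / a uses up at most half of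
    \<epsilon>, and fixed before any control is considered.\<close>
  define a where "a = nat \<lceil>2 * \<kappa>1 / \<epsilon>\<rceil>"
  have a: "2 * \<kappa>1 / \<epsilon> \<le> real a" unfolding a_def by linarith
  have a0: "0 < real a" using a \<epsilon> \<kappa>1 by (smt (verit) divide_pos_pos)
  have step: "\<kappa>1 / a \<le> \<epsilon> / 2"
    using a a0 \<epsilon> by (simp add: field_simps)
  define h :: "nat \<Rightarrow> real" where "h k = min 1 (real (k + 1) / a)" for k
  have h: "0 \<le> h k" "h k \<le> 1" for k
    by (auto simp: h_def)
  have h_Suc: "h (Suc k) \<le> h k + 1 / a" for k
  proof -
    have "real (Suc k + 1) / a = real (k + 1) / a + 1 / a" by (simp add: add_divide_distrib)
    moreover have "0 \<le> 1 / real a" by simp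
    ultimately show ?thesis unfolding h_def by linarith
  qed
  have h_0: "h 0 \<le> 1 / a" by (simp add: h_def)
  \<comment> \<open>The shift by one in \<open>h\<close> matters: from a state with first coordinate
    \<open>Suc k\<close> the downward increment involves \<open>h k\<close>, which must already be 1
    when that coordinate reaches \<open>a\<close>.\<close>
  have h_large: "h k = 1" if "a \<le> Suc k" for k
    using that a0 by (simp add: h_def)
  define V :: "state \<Rightarrow> real" where "V n = (\<Sum>i<fst n. h i) / \<mu>1 + real (snd n) / \<mu>2" for n
  have V: "0 \<le> V n" for n
    unfolding V_def using h assms by (auto intro!: add_nonneg_nonneg divide_nonneg_pos sum_nonneg)
  show ?thesis
  proof (intro exI[of _ a] conjI allI impI; (elim conjE exE)?)
    show "a \<ge> 1" using a0 by simp
  next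
    fix b F
    assume b: "is_control b" and pareto: "pareto_efficient c1 c2 b" and F: "finite F"
      and hyp: "\<forall>n. fst n < a \<and> n \<notin> F \<longrightarrow> \<kappa>2 - snd (b n) \<le> - \<delta>"
    have "drift \<nu>1 \<nu>2 \<mu>1 \<mu>2 b V n \<le> - (\<epsilon> / 2)" if nF: "n \<notin> F" for n
    proof -
      have b0: "0 \<le> fst (b n)" "0 \<le> snd (b n)"
        and b1: "fst n = 0 \<Longrightarrow> fst (b n) = 0" and b2: "snd n = 0 \<Longrightarrow> snd (b n) = 0"
        using b unfolding is_control_def by blast+
      have up: "\<nu>1 * (V (fst n + 1, snd n) - V n) = \<kappa>1 * h (fst n)"
        "\<nu>2 * (V (fst n, snd n + 1) - V n) = \<kappa>2"
        using assms by (auto simp: V_def field_simps)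
      have down2: "\<mu>2 * snd (b n) * (V (fst n, snd n - 1) - V n) = - snd (b n)"
        using b2 assms by (cases "snd n") (auto simp: V_def field_simps)
      have hyp_n: "\<kappa>2 - snd (b n) \<le> - \<delta>" if "fst n < a"
        using hyp nF that by blast
      show ?thesis
      proof (cases "fst n")
        \<comment> \<open>Here no type 1 call forces resource 1 to be saturated, so the decay comes
          from type 2 alone and \<open>h 0\<close> is small.\<close>
        case 0
        have "\<kappa>1 * h 0 \<le> \<kappa>1 / a"
          using mult_left_mono[OF h_0, of \<kappa>1] \<kappa>1 by simp
        moreover have "\<kappa>2 - snd (b n) \<le> - \<delta>"
          using hyp_n 0 a0 by simp
        moreover have "drift \<nu>1 \<nu>2 \<mu>1 \<mu>2 b V n = \<kappa>1 * h 0 + \<kappa>2 - snd (b n)"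
          unfolding drift_def up down2 using 0 b1 by simp
        ultimately show ?thesis
          using step \<epsilon> by linarith
      next
        case (Suc k)
        have sat: "fst (b n) = c1 - snd (b n)"
          using pareto Suc unfolding pareto_efficient_def saturated1_def
          by (metis add_diff_cancel_right' zero_less_Suc)
        have down1: "\<mu>1 * fst (b n) * (V (fst n - 1, snd n) - V n) = - (fst (b n) * h k)"
          using Suc assms by (simp add: V_def field_simps)
        have D: "drift \<nu>1 \<nu>2 \<mu>1 \<mu>2 b V n =
            \<kappa>1 * h (Suc k) + \<kappa>2 - (c1 - snd (b n)) * h k - snd (b n)"
          unfolding drift_def up down1 down2 by (simp add: sat Suc)
        show ?thesis
        proof (cases "Suc k < a")
          case True
          have "\<kappa>1 * h (Suc k) \<le> \<kappa>1 * (h k + 1 / a)"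
            using h_Suc \<kappa>1 by (intro mult_left_mono) auto
          \<comment> \<open>Saturation of resource 1 lets the drift be regrouped as a convex
            combination of the type 2 drift and the workload drift, with weight \<open>h k\<close>,
            plus the error from \<open>h (Suc k)\<close>.\<close>
          then have "drift \<nu>1 \<nu>2 \<mu>1 \<mu>2 b V n \<le>
              (\<kappa>2 - snd (b n)) * (1 - h k) + (\<kappa>1 + \<kappa>2 - c1) * h k + \<kappa>1 / a"
            unfolding D by (simp add: algebra_simps)
          also have "\<dots> \<le> - \<epsilon> * (1 - h k) + - \<epsilon> * h k + \<epsilon> / 2"
            using hyp_n True Suc \<epsilon> h[of k] step by (intro add_mono mult_right_mono) auto
          finally show ?thesis by (simp add: algebra_simps)
        next
          \<comment> \<open>Beyond \<open>a\<close> both increments have full weight, and the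
            workload drift does not depend on how the capacity is split.\<close>
          case False
          then have "h k = 1" "h (Suc k) = 1" by (auto intro: h_large)
          then show ?thesis unfolding D using \<epsilon> by simp
        qed
      qed
    qed
    note D = this
    show "stable_control \<nu>1 \<nu>2 \<mu>1 \<mu>2 b"
      using \<epsilon>(1)
      by (intro stable_control_if_drift_negative_off_finite[OF b pareto assms(7,8,1-4) F _ V D]) auto
  qed
qed

end
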